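(* The set $\mathbf{O}=\{A : \mathbf{P}^A\neq\mathbf{NP}^A\}\subseteq 2^\omega$ is $\boldsymbol{\Pi}^0_2$-hard; that is, $\mathbf{O}\notin\boldsymbol{\Sigma}^0_2$.
   Context: Binary strings are identified with natural numbers via a fixed effective enumeration of $\{0,1\}^{<\omega}$, so that an oracle (a set of binary strings) is identified with an element of the Cantor space $2^\omega$ (with the product topology). $\mathbf{P}^A,\mathbf{NP}^A$ are the relativized complexity classes. $\boldsymbol{\Sigma}^0_2$ denotes the (boldface) class of countable unions of closed subsets of $2^\omega$, and $\boldsymbol{\Pi}^0_2$ the class of countable intersections of open sets. A set is $\boldsymbol{\Pi}^0_2$-hard if it is not in $\boldsymbol{\Sigma}^0_2$. *)

theory Defs
  imports "HOL-Analysis.Analysis" "HOL-Computational_Algebra.Polynomial"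
begin

section \<open>Binary strings, oracles and the Cantor space\<close>

text \<open>Length-lexicographic enumeration: the string with index \<open>n\<close> is the binary expansion of
  \<open>n + 1\<close> (most significant digit first) without its leading \<open>1\<close>.\<close>

definition string_index :: "bool list \<Rightarrow> nat" where
  "string_index w = foldl (\<lambda>n b. 2 * n + (if b then 2 else 1)) 0 w"

lemma string_index_simps:
  "string_index [] = 0"
  "string_index (w @ [b]) = 2 * string_index w + (if b then 2 else 1)"
  by (simp_all add: string_index_def)

lemma bij_string_index: "bij string_index"
proof (rule bijI)
  show "inj string_index"
  proof (rule injI)
    fix v w
    show "string_index v = string_index w \<Longrightarrow> v = w"
    proof (induction v arbitrary: w rule: rev_induct)
      case Nil
      then show ?case
        by (cases w rule: rev_cases) (auto simp: string_index_simps split: if_splits)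
    next
      case (snoc b v)
      show ?case
      proof (cases w rule: rev_cases)
        case Nil
        then show ?thesis
          using snoc.prems by (auto simp: string_index_simps split: if_splits)
      next
        case (snoc w' c)
        have eq: "2 * string_index v + (if b then 2 else 1)
                = 2 * string_index w' + (if c then 2 else 1)"
          using snoc snoc.prems by (simp add: string_index_simps)
        have "b = c \<and> string_index v = string_index w'"
          using eq by (cases b; cases c) (simp, presburger, presburger, simp)
        then show ?thesis
          using snoc snoc.IH[of w'] by simp
      qed
    qed
  qed
next
  have "\<exists>w. string_index w = n" for n
  proof (induction n rule: less_induct)
    case (less n)
    show ?case
    proof (cases "n = 0")
      case True
      then show ?thesis using string_index_simps(1) by blast
    next
      case False
      then have "(n - 1) div 2 < n" by linarith
      then obtain w where w: "string_index w = (n - 1) div 2"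
        using less by blast
      have "string_index (w @ [even n]) = n"
        using False by (auto simp: string_index_simps w elim!: evenE oddE)
      then show ?thesis by blast
    qed
  qed
  then show "surj string_index" by (metis surjI)
qed

text \<open>The Cantor space is the type \<open>nat \<Rightarrow> bool\<close> with its instance of
  \<^class>\<open>topological_space\<close>: the product of the discrete topologies.\<close>

definition oracle_of :: "(nat \<Rightarrow> bool) \<Rightarrow> bool list set" where
  "oracle_of \<alpha> = {w. \<alpha> (string_index w)}"

lemma bij_oracle_of: "bij oracle_of"
proof (rule bijI)
  show "inj oracle_of"
  proof (rule injI, rule ext)
    fix \<alpha> \<beta> :: "nat \<Rightarrow> bool" and n
    assume "oracle_of \<alpha> = oracle_of \<beta>"
    moreover obtain w where "n = string_index w"
      using bij_string_index by (metis bij_pointE)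
    ultimately show "\<alpha> n = \<beta> n" by (auto simp: oracle_of_def set_eq_iff)
  qed
  show "surj oracle_of"
  proof (rule surjI)
    fix A
    show "oracle_of (\<lambda>n. n \<in> string_index ` A) = A"
      using bij_string_index by (auto simp: oracle_of_def bij_def inj_image_mem_iff)
  qed
qed

section \<open>Oracle Turing machines\<close>

text \<open>Multi-tape machines over an arbitrary finite alphabet containing the blank and the two bits.
  Tapes are infinite in both directions.  Tape \<open>0\<close> initially holds the input, in the cells
  \<open>0, 1, \<dots>\<close>; tape \<open>1\<close> is the query tape; the remaining tapes are work tapes.  A tape is given by
  its head position and its contents.\<close>

datatype tape_symbol = Blank | Bit bool | Aux nat

datatype head_move = Go_left | Stay | Go_right

type_synonym tape = "int \<times> (int \<Rightarrow> tape_symbol)"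

type_synonym configuration = "nat \<times> tape list"

text \<open>A rule \<open>(q, ss, q', as)\<close> applies in state \<open>q\<close> when the heads scan the symbols \<open>ss\<close>; each
  head then performs its write-and-move action in \<open>as\<close> and the new state is \<open>q'\<close>.\<close>

type_synonym rule = "nat \<times> tape_symbol list \<times> nat \<times> (tape_symbol \<times> head_move) list"

datatype otm = OTM (num_tapes: nat) (rules: "rule set")
  (start_state: nat) (accept_state: nat) (query_state: nat) (yes_state: nat) (no_state: nat)

text \<open>Finiteness of the rule set also makes the sets of states and of tape symbols in use finite.\<close>

definition well_formed :: "otm \<Rightarrow> bool" where
  "well_formed M \<longleftrightarrow>
     2 \<le> num_tapes M \<and>
     finite (rules M) \<and>
     distinct [accept_state M, query_state M, yes_state M, no_state M] \<and>
     (\<forall>(q, ss, q', as) \<in> rules M.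
        length ss = num_tapes M \<and> length as = num_tapes M \<and>
        q \<noteq> accept_state M \<and> q \<noteq> query_state M)"

definition deterministic :: "otm \<Rightarrow> bool" where
  "deterministic M \<longleftrightarrow>
     (\<forall>q ss q\<^sub>1 as\<^sub>1 q\<^sub>2 as\<^sub>2. (q, ss, q\<^sub>1, as\<^sub>1) \<in> rules M \<and> (q, ss, q\<^sub>2, as\<^sub>2) \<in> rules M
        \<longrightarrow> q\<^sub>1 = q\<^sub>2 \<and> as\<^sub>1 = as\<^sub>2)"

fun scanned :: "tape \<Rightarrow> tape_symbol" where
  "scanned (h, f) = f h"

fun act :: "tape_symbol \<times> head_move \<Rightarrow> tape \<Rightarrow> tape" where
  "act (s, m) (h, f) =
     (case m of Go_left \<Rightarrow> h - 1 | Stay \<Rightarrow> h | Go_right \<Rightarrow> h + 1, f(h := s))"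

text \<open>The string queried is the maximal block of bits on the query tape that begins in cell \<open>0\<close>;
  the head position is irrelevant, and answering the query leaves all tapes unchanged.\<close>

fun tape_word :: "tape \<Rightarrow> bool list" where
  "tape_word (h, f) =
     map (\<lambda>i. f (int i) = Bit True) [0..<(LEAST n. f (int n) \<notin> range Bit)]"

inductive step :: "otm \<Rightarrow> bool list set \<Rightarrow> configuration \<Rightarrow> configuration \<Rightarrow> bool"
  for M :: otm and A :: "bool list set" where
  rule: "(q, map scanned ts, q', as) \<in> rules M \<Longrightarrow> step M A (q, ts) (q', map2 act as ts)"
| query: "step M A (query_state M, ts)
            (if tape_word (ts ! 1) \<in> A then yes_state M else no_state M, ts)"

definition input_tape :: "bool list \<Rightarrow> tape" where
  "input_tape x = (0, \<lambda>i. if 0 \<le> i \<and> i < int (length x) then Bit (x ! nat i) else Blank)"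

definition initial :: "otm \<Rightarrow> bool list \<Rightarrow> configuration" where
  "initial M x =
     (start_state M, input_tape x # replicate (num_tapes M - 1) (0, \<lambda>_. Blank))"

text \<open>A computation path halts when no step is possible; halting in any state other than the
  accepting one means rejection.\<close>

definition accepted_language :: "otm \<Rightarrow> bool list set \<Rightarrow> bool list set" where
  "accepted_language M A =
     {x. \<exists>c. (step M A)\<^sup>*\<^sup>* (initial M x) c \<and> fst c = accept_state M}"

text \<open>The time bound concerns every computation path on every input.\<close>

definition runs_in_time :: "otm \<Rightarrow> bool list set \<Rightarrow> (nat \<Rightarrow> nat) \<Rightarrow> bool" where
  "runs_in_time M A t \<longleftrightarrow>
     (\<forall>x n c. (step M A ^^ n) (initial M x) c \<longrightarrow> n \<le> t (length x))"

section \<open>The relativized complexity classes\<close>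

definition P_class :: "bool list set \<Rightarrow> bool list set set" where
  "P_class A = {L. \<exists>M (p :: nat poly).
     well_formed M \<and> deterministic M \<and> runs_in_time M A (poly p) \<and> L = accepted_language M A}"

definition NP_class :: "bool list set \<Rightarrow> bool list set set" where
  "NP_class A = {L. \<exists>M (p :: nat poly).
     well_formed M \<and> runs_in_time M A (poly p) \<and> L = accepted_language M A}"

section \<open>Borel hardness\<close>

definition Sigma02 :: "'a::topological_space set set" where
  "Sigma02 = {S. fsigma S}"

definition Pi02_hard :: "'a::topological_space set \<Rightarrow> bool" where
  "Pi02_hard S \<longleftrightarrow> S \<notin> Sigma02"

definition P_neq_NP_oracles :: "(nat \<Rightarrow> bool) set" where
  "P_neq_NP_oracles = {\<alpha>. P_class (oracle_of \<alpha>) \<noteq> NP_class (oracle_of \<alpha>)}"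

end

theory Submission
  imports Defs
begin

text \<open>Let \<open>L A\<close> be the set of strings whose length is attained in \<open>A\<close>; it is in \<open>NP\<close> relative to \<open>A\<close>.
  For a machine \<open>M\<close> and a polynomial \<open>p\<close>, the oracles relative to which \<open>M\<close> decides \<open>L A\<close> in time \<open>p\<close>
  form a closed set, and by the diagonal argument of Baker, Gill and Solovay it has empty interior.
  These countably many sets cover the oracles with \<open>P = NP\<close>.  If the remaining oracles were a
  countable union of closed sets, then by the Baire category theorem one of those would contain a
  cylinder; but \<open>P = NP\<close> holds on a dense set.

  For density, every finite condition extends to an oracle that answers, for strings carrying
  sufficient padding, whether a given nondeterministic machine with a clock accepts a given input.
  The oracle also tells when the padding is long enough, so that the deterministic machine using it
  need not compute the clock.\<close>

section \<open>Oracles agreeing on short strings\<close>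

definition agree_below :: "nat \<Rightarrow> bool list set \<Rightarrow> bool list set \<Rightarrow> bool" where
  "agree_below n A B \<longleftrightarrow> (\<forall>w. length w < n \<longrightarrow> (w \<in> A \<longleftrightarrow> w \<in> B))"

lemma agree_belowD: "agree_below n A B \<Longrightarrow> length w < n \<Longrightarrow> w \<in> A \<longleftrightarrow> w \<in> B"
  by (simp add: agree_below_def)

lemma agree_below_mono: "agree_below n A B \<Longrightarrow> m \<le> n \<Longrightarrow> agree_below m A B"
  by (auto simp: agree_below_def)

lemma agree_below_sym: "agree_below n A B \<Longrightarrow> agree_below n B A"
  by (auto simp: agree_below_def)

lemma length_le_string_index: "length w \<le> string_index w"
  by (induction w rule: rev_induct) (auto simp: string_index_simps)

lemma finite_lists_shorter: "finite {w :: bool list. length w < n}"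
  by (rule finite_subset[OF _ finite_lists_length_le[OF finite, where n = n]]) auto

lemma open_cylinder: "open {\<beta>. agree_below n A (oracle_of \<beta>)}"
proof -
  have "open ((\<lambda>\<beta> :: nat \<Rightarrow> bool. \<beta> i) -` {b})" for i b
    by (intro open_vimage open_discrete continuous_on_product_coordinates)
  then have "open (\<Inter>w\<in>{w. length w < n}. (\<lambda>\<beta>. \<beta> (string_index w)) -` {w \<in> A})"
    by (intro open_INT finite_lists_shorter) auto
  also have "(\<Inter>w\<in>{w. length w < n}. (\<lambda>\<beta>. \<beta> (string_index w)) -` {w \<in> A})
      = {\<beta>. agree_below n A (oracle_of \<beta>)}"
    by (auto simp: agree_below_def oracle_of_def)
  finally show ?thesis .
qed

lemma agree_below_oracle_of:
  assumes "agree_below n (oracle_of \<alpha>) (oracle_of \<beta>)" "i < n"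
  shows "\<alpha> i = \<beta> i"
proof -
  obtain w where w: "string_index w = i"
    using bij_string_index by (metis bij_pointE)
  then have "length w < n"
    using length_le_string_index[of w] assms(2) by simp
  then show ?thesis
    using assms(1) w by (auto simp: agree_below_def oracle_of_def)
qed

text \<open>A basic open set of the product restricts finitely many coordinates, all below some
  \<open>n\<close>. Such a coordinate belongs to a string shorter than \<open>n\<close>, since no
  string is longer than its index.\<close>

lemma open_iff_cylinder:
  "open S \<longleftrightarrow> (\<forall>\<alpha>\<in>S. \<exists>n. \<forall>\<beta>. agree_below n (oracle_of \<alpha>) (oracle_of \<beta>) \<longrightarrow> \<beta> \<in> S)"
  (is "?L \<longleftrightarrow> ?R")
proof
  assume "open S"
  show ?R
  proof
    fix \<alpha> assume "\<alpha> \<in> S"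
    then obtain X where X: "\<alpha> \<in> Pi\<^sub>E UNIV X" "finite {i. X i \<noteq> UNIV}" "Pi\<^sub>E UNIV X \<subseteq> S"
      using product_topology_open_contains_basis[of "\<lambda>_. euclidean" UNIV S \<alpha>] \<open>open S\<close>
      by (auto simp: open_fun_def)
    obtain n where n: "\<forall>i\<in>{i. X i \<noteq> UNIV}. i < n"
      using X(2) finite_nat_set_iff_bounded by blast
    have "\<beta> \<in> S" if "agree_below n (oracle_of \<alpha>) (oracle_of \<beta>)" for \<beta>
    proof -
      have "\<beta> i \<in> X i" for i
      proof (cases "X i = UNIV")
        case False
        then have "\<alpha> i = \<beta> i" using agree_below_oracle_of[OF that] n by blast
        then show ?thesis using X(1) by (auto simp: PiE_iff dest: spec[of _ i])
      qed simp
      then show ?thesis using X(3) by (auto simp: PiE_iff)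
    qed
    then show "\<exists>n. \<forall>\<beta>. agree_below n (oracle_of \<alpha>) (oracle_of \<beta>) \<longrightarrow> \<beta> \<in> S" by blast
  qed
next
  assume R: ?R
  show "open S"
  proof (subst open_subopen, intro ballI)
    fix \<alpha> assume "\<alpha> \<in> S"
    then obtain n where "\<forall>\<beta>. agree_below n (oracle_of \<alpha>) (oracle_of \<beta>) \<longrightarrow> \<beta> \<in> S"
      using R by blast
    then show "\<exists>T. open T \<and> \<alpha> \<in> T \<and> T \<subseteq> S"
      by (intro exI[of _ "{\<beta>. agree_below n (oracle_of \<alpha>) (oracle_of \<beta>)}"] conjI open_cylinder)
        (auto simp: agree_below_def)
  qed
qed

lemma Hausdorff_space_euclidean_t2: "Hausdorff_space (euclidean :: 'a::t2_space topology)"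
  by (simp add: Hausdorff_space_def disjnt_def) (metis hausdorff)

text \<open>The Cantor space is compact Hausdorff, hence locally compact and regular, so the Baire
  category theorem applies: some member of the cover has an interior point, around which
  \<open>open_iff_cylinder\<close> gives a cylinder.\<close>

lemma Baire_Cantor_space:
  fixes \<G> :: "(nat \<Rightarrow> bool) set set"
  assumes "countable \<G>" "\<And>T. T \<in> \<G> \<Longrightarrow> closed T" "\<Union>\<G> = UNIV"
  obtains T A n where "T \<in> \<G>" "\<And>\<beta>. agree_below n A (oracle_of \<beta>) \<Longrightarrow> \<beta> \<in> T"
proof -
  let ?X = "product_topology (\<lambda>_. euclidean) UNIV :: (nat \<Rightarrow> bool) topology"
  have "compact_space (euclidean :: bool topology)"
    by (simp add: compact_space_def finite_imp_compact)
  then have "compact_space ?X"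
    by (simp add: compact_space_product_topology)
  moreover have "Hausdorff_space (euclidean :: bool topology)"
    by (rule Hausdorff_space_euclidean_t2)
  then have "Hausdorff_space ?X"
    by (simp add: Hausdorff_space_product_topology)
  ultimately have "locally_compact_space ?X \<and> regular_space ?X"
    by (simp add: compact_imp_locally_compact_space compact_Hausdorff_imp_regular_space)
  moreover have "?X interior_of \<Union>\<G> \<noteq> {}"
    using assms(3) by (simp add: euclidean_product_topology)
  ultimately obtain T where T: "T \<in> \<G>" "interior T \<noteq> {}"
    using Baire_category_alt[of ?X \<G>] assms(1,2) by (auto simp: euclidean_product_topology)
  then obtain \<alpha> where "\<alpha> \<in> interior T" by blast
  then obtain n where "\<And>\<beta>. agree_below n (oracle_of \<alpha>) (oracle_of \<beta>) \<Longrightarrow> \<beta> \<in> interior T"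
    using open_iff_cylinder[of "interior T"] by auto
  with T(1) that show thesis using interior_subset by blast
qed

section \<open>Locality of computations\<close>

lemma accept_halts:
  assumes "well_formed M" "fst c = accept_state M"
  shows "\<not> step M A c c'"
  using assms by (auto simp: well_formed_def elim!: step.cases)

text \<open>\<open>deterministic\<close> restrains only the rules; that no rule competes with an
  oracle answer comes from \<open>well_formed\<close>, which excludes rules in the query
  state.\<close>

lemma right_unique_step:
  assumes "well_formed M" "deterministic M"
  shows "right_unique (step M A)"
proof (rule right_uniqueI)
  fix c c\<^sub>1 c\<^sub>2 assume "step M A c c\<^sub>1" "step M A c c\<^sub>2"
  then show "c\<^sub>1 = c\<^sub>2"
    using assms unfolding well_formed_def deterministic_def
    by (elim step.cases) blast+
qed

text \<open>Serves to bound all runs of a deterministic machine by exhibiting a single halting one.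
  In the induction the remaining run cannot be empty, as \<open>d\<close> has no successor, and its
  first step is forced.\<close>

lemma right_unique_run:
  assumes "right_unique R" "(R ^^ N) a d" "\<And>e. \<not> R d e" "(R ^^ n) a c"
  shows "\<exists>m. N = n + m \<and> (R ^^ m) c d"
  using assms(4)
proof (induction n arbitrary: c)
  case 0
  then show ?case using assms(2) by auto
next
  case (Suc n)
  then obtain b where b: "(R ^^ n) a b" "R b c" by (auto elim: relpowp_Suc_E)
  then obtain m where m: "N = n + m" "(R ^^ m) b d" using Suc.IH by blast
  then show ?case
  proof (cases m)
    case 0
    then show ?thesis using m b assms(3) by auto
  next
    case (Suc m')
    then obtain c' where "R b c'" "(R ^^ m') c' d" using m(2) by (metis relpowp_Suc_D2)
    then show ?thesis using assms(1) b(2) m(1) Suc by (auto dest: right_uniqueD)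
  qed
qed

text \<open>A step writes only under the head and moves it by at most one cell. The head position is
  included to carry the induction; the blank cell \<open>n\<close> will bound the length of a
  query.\<close>

lemma query_tape_bound:
  assumes "well_formed M" "(step M A ^^ n) (initial M x) (q, ts)"
  shows "length ts = num_tapes M \<and> fst (ts ! 1) \<le> int n \<and> (\<forall>i\<ge>int n. snd (ts ! 1) i = Blank)"
  using assms(2)
proof (induction n arbitrary: q ts)
  case 0
  then show ?case using assms(1) by (auto simp: initial_def well_formed_def)
next
  case (Suc n)
  then obtain q' ts' where *: "(step M A ^^ n) (initial M x) (q', ts')"
    "step M A (q', ts') (q, ts)"
    by (auto elim: relpowp_Suc_E)
  note IH = Suc.IH[OF *(1)]
  from *(2) show ?case
  proof cases
    case (rule as)
    obtain s m where sm: "as ! 1 = (s, m)" by fastforce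
    obtain h f where hf: "ts' ! 1 = (h, f)" by fastforce
    have "length as = num_tapes M" "1 < num_tapes M"
      using rule(2) assms(1) by (auto simp: well_formed_def)
    then have "length ts = num_tapes M" "ts ! 1 = act (s, m) (h, f)"
      using rule(1) IH sm hf by auto
    then show ?thesis using IH hf by (auto split: head_move.splits)
  next
    case query
    then show ?thesis using IH by auto
  qed
qed

lemma length_query:
  assumes "well_formed M" "(step M A ^^ n) (initial M x) (q, ts)"
  shows "length (tape_word (ts ! 1)) \<le> n"
proof -
  obtain h f where hf: "ts ! 1 = (h, f)" by fastforce
  then have "f (int n) \<notin> range Bit"
    using query_tape_bound[OF assms] by auto
  then show ?thesis using hf by (auto intro: Least_le)
qed

text \<open>A query answered in step \<open>Suc n\<close> was written in \<open>n\<close> steps, so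
  it is shorter than \<open>Suc n\<close>.\<close>

lemma run_agree:
  assumes "well_formed M" "agree_below n A B" "(step M A ^^ n) (initial M x) c"
  shows "(step M B ^^ n) (initial M x) c"
  using assms(2,3)
proof (induction n arbitrary: c)
  case 0
  then show ?case by simp
next
  case (Suc n)
  then obtain b where b: "(step M A ^^ n) (initial M x) b" "step M A b c"
    by (auto elim: relpowp_Suc_E)
  have "agree_below n A B" using Suc.prems(1) agree_below_mono by fastforce
  then have "(step M B ^^ n) (initial M x) b" using Suc.IH b(1) by blast
  moreover from b(2) have "step M B b c"
  proof cases
    case (rule q ts q' as)
    then show ?thesis using step.rule by blast
  next
    case (query ts)
    have "length (tape_word (ts ! 1)) < Suc n"
      using length_query[OF assms(1)] b(1) query(1) by (simp add: less_Suc_eq_le)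
    then have "tape_word (ts ! 1) \<in> A \<longleftrightarrow> tape_word (ts ! 1) \<in> B"
      using Suc.prems(1) agree_belowD by blast
    then show ?thesis using query step.query[of M B ts] by simp
  qed
  ultimately show ?case by (rule relpowp_Suc_I)
qed

text \<open>Acceptance with a clock: for a well-formed machine it depends on finitely many oracle
  strings, even if the machine overruns the clock.\<close>

definition accepts_within :: "otm \<Rightarrow> bool list set \<Rightarrow> nat \<Rightarrow> bool list \<Rightarrow> bool" where
  "accepts_within M A t x \<longleftrightarrow>
     (\<exists>n\<le>t. \<exists>c. (step M A ^^ n) (initial M x) c \<and> fst c = accept_state M)"

lemma accepted_language_eq: "accepted_language M A = {x. \<exists>t. accepts_within M A t x}"
  by (auto simp: accepted_language_def accepts_within_def rtranclp_power)

lemma accepts_within_iff: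
  "runs_in_time M A t \<Longrightarrow> accepts_within M A (t (length x)) x \<longleftrightarrow> x \<in> accepted_language M A"
  unfolding accepted_language_eq accepts_within_def runs_in_time_def by blast

lemma accepts_within_agree:
  assumes "well_formed M" "agree_below t A B"
  shows "accepts_within M A t x \<longleftrightarrow> accepts_within M B t x"
  unfolding accepts_within_def
  using run_agree[OF assms(1)] agree_below_mono[OF assms(2)]
    agree_below_mono[OF agree_below_sym[OF assms(2)]] by blast

section \<open>Encoding strings on tapes\<close>

definition cells :: "bool list \<Rightarrow> int \<Rightarrow> tape_symbol" where
  "cells w i = (if 0 \<le> i \<and> i < int (length w) then Bit (w ! nat i) else Blank)"

lemma cells_bit [simp]: "i < length w \<Longrightarrow> cells w (int i) = Bit (w ! i)"
  and cells_end [simp]: "cells w (int (length w)) = Blank"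
  by (auto simp: cells_def)

lemma cells_append: "(cells w)(int (length w) := Bit b) = cells (w @ [b])"
  by (auto simp: cells_def fun_eq_iff nth_append)

lemma fun_upd_scanned: "f h = s \<Longrightarrow> f(h := s) = f"
  by auto

lemma tape_word_cells [simp]: "tape_word (h, cells w) = w"
proof -
  have "(LEAST n. cells w (int n) \<notin> range Bit) = length w"
    by (rule Least_equality) (auto simp: cells_def split: if_splits)
  then show ?thesis
    by (auto simp: map_nth intro!: nth_equalityI)
qed

definition end_tape :: "bool list \<Rightarrow> tape" where
  "end_tape w = (int (length w), cells w)"

lemma scanned_end_tape [simp]: "scanned (end_tape w) = Blank"
  by (simp add: end_tape_def)

lemma tape_word_end_tape [simp]: "tape_word (end_tape w) = w"
  by (simp add: end_tape_def del: tape_word.simps)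

lemma act_end_tape [simp]:
  "act (Bit b, Go_right) (end_tape w) = end_tape (w @ [b])"
  "act (Blank, Stay) (end_tape w) = end_tape w"
  by (simp_all add: end_tape_def cells_append fun_upd_scanned)

definition tape_at :: "bool list \<Rightarrow> nat \<Rightarrow> tape" where
  "tape_at w i = (int i, cells w)"

lemma tape_at_length: "tape_at w (length w) = end_tape w"
  by (simp add: tape_at_def end_tape_def)

lemma scanned_tape_at [simp]: "i < length w \<Longrightarrow> scanned (tape_at w i) = Bit (w ! i)"
  by (simp add: tape_at_def)

lemma act_tape_at [simp]:
  "i < length w \<Longrightarrow> act (Bit (w ! i), Go_right) (tape_at w i) = tape_at w (Suc i)"
  "scanned (tape_at w i) = s \<Longrightarrow> act (s, Stay) (tape_at w i) = tape_at w i"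
  by (auto simp: tape_at_def fun_upd_scanned)

lemma initial_two_tapes:
  "num_tapes M = 2 \<Longrightarrow> initial M x = (start_state M, [tape_at x 0, end_tape []])"
  by (simp add: initial_def input_tape_def tape_at_def end_tape_def cells_def fun_eq_iff)

section \<open>An \<open>NP\<close> language diagonalizing against \<open>P\<close>\<close>

definition length_language :: "bool list set \<Rightarrow> bool list set" where
  "length_language A = {x. \<exists>w\<in>A. length w = length x}"

text \<open>The states \<open>0\<close>, \<open>1\<close>, \<open>2\<close>, \<open>3\<close> accept, query, and receive the answers yes and no.\<close>

definition guess_machine :: otm where
  "guess_machine = OTM 2
     ({(4, [Bit b, Blank], 4, [(Bit b, Go_right), (Bit c, Go_right)]) |b c. True} \<union>
      {(4, [Blank, Blank], 1, [(Blank, Stay), (Blank, Stay)]),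
       (2, [Blank, Blank], 0, [(Blank, Stay), (Blank, Stay)])})
     4 0 1 2 3"

lemma guess_machine_sel [simp]:
  "num_tapes guess_machine = 2" "start_state guess_machine = 4"
  "accept_state guess_machine = 0" "query_state guess_machine = 1"
  "yes_state guess_machine = 2" "no_state guess_machine = 3"
  by (simp_all add: guess_machine_def)

lemma well_formed_guess_machine: "well_formed guess_machine"
proof -
  have "finite {(4 :: nat, [Bit b, Blank], 4 :: nat, [(Bit b, Go_right), (Bit c, Go_right)]) |b c. True}"
    by (rule finite_subset[OF _ finite_imageI[OF finite, where F = UNIV and h =
          "\<lambda>(b, c). (4, [Bit b, Blank], 4, [(Bit b, Go_right), (Bit c, Go_right)])"]]) auto
  then show ?thesis
    by (auto simp: well_formed_def guess_machine_def)
qed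

text \<open>An invariant for all branches: the bits of \<open>w\<close> are guessed while the input
  is traversed, then \<open>w\<close> is queried. It yields both the time bound and the soundness of
  acceptance.\<close>

lemma guess_machine_run:
  assumes "(step guess_machine A ^^ n) (initial guess_machine x) c"
  shows "\<exists>w. n \<le> length x \<and> length w = n \<and> c = (4, [tape_at x n, end_tape w]) \<or>
     length w = length x \<and>
     (n = length x + 1 \<and> c = (1, [end_tape x, end_tape w]) \<or>
      n = length x + 2 \<and> c = (if w \<in> A then 2 else 3, [end_tape x, end_tape w]) \<or>
      n = length x + 3 \<and> w \<in> A \<and> c = (0, [end_tape x, end_tape w]))"
  using assms
proof (induction n arbitrary: c)
  case 0
  then show ?case by (auto simp: initial_two_tapes)
next
  case (Suc n)
  then obtain b where b: "(step guess_machine A ^^ n) (initial guess_machine x) b"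
    "step guess_machine A b c"
    by (auto elim: relpowp_Suc_E)
  from Suc.IH[OF b(1)] obtain w where
    "n \<le> length x \<and> length w = n \<and> b = (4, [tape_at x n, end_tape w]) \<or>
     length w = length x \<and>
     (n = length x + 1 \<and> b = (1, [end_tape x, end_tape w]) \<or>
      n = length x + 2 \<and> b = (if w \<in> A then 2 else 3, [end_tape x, end_tape w]) \<or>
      n = length x + 3 \<and> w \<in> A \<and> b = (0, [end_tape x, end_tape w]))" by blast
  then consider
    (loop) "n < length x" "length w = n" "b = (4, [tape_at x n, end_tape w])"
  | (ask) "n = length x" "length w = n" "b = (4, [end_tape x, end_tape w])"
  | (answer) "n = length x + 1" "length w = length x" "b = (1, [end_tape x, end_tape w])"
  | (yes) "n = length x + 2" "length w = length x" "w \<in> A" "b = (2, [end_tape x, end_tape w])"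
  | (no) "b = (3, [end_tape x, end_tape w])"
  | (acc) "b = (0, [end_tape x, end_tape w])"
    by (auto simp: tape_at_length le_less split: if_splits)
  then show ?case
  proof cases
    case loop
    then obtain d where "c = (4, [tape_at x (Suc n), end_tape (w @ [d])])"
      using b(2) by (auto simp: guess_machine_def elim!: step.cases)
    then show ?thesis using loop by (intro exI[of _ "w @ [d]"]) auto
  next
    case ask
    then show ?thesis using b(2)
      by (intro exI[of _ w]) (auto simp: guess_machine_def elim!: step.cases)
  next
    case answer
    then show ?thesis using b(2)
      by (intro exI[of _ w]) (auto simp: guess_machine_def elim!: step.cases)
  next
    case yes
    then show ?thesis using b(2)
      by (intro exI[of _ w]) (auto simp: guess_machine_def elim!: step.cases)
  next
    case no
    then show ?thesis using b(2) by (auto simp: guess_machine_def elim!: step.cases)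
  next
    case acc
    then show ?thesis using b(2) by (auto simp: guess_machine_def elim!: step.cases)
  qed
qed

lemma guess_machine_guesses:
  assumes "length w = length x" "n \<le> length x"
  shows "(step guess_machine A ^^ n) (initial guess_machine x) (4, [tape_at x n, end_tape (take n w)])"
  using assms(2)
proof (induction n)
  case 0
  then show ?case by (simp add: initial_two_tapes)
next
  case (Suc n)
  have "step guess_machine A (4, [tape_at x n, end_tape (take n w)])
      (4, map2 act [(Bit (x ! n), Go_right), (Bit (w ! n), Go_right)] [tape_at x n, end_tape (take n w)])"
    using Suc.prems by (intro step.rule) (simp add: guess_machine_def)
  then have "step guess_machine A (4, [tape_at x n, end_tape (take n w)])
      (4, [tape_at x (Suc n), end_tape (take (Suc n) w)])"
    using Suc.prems assms(1) by (simp add: take_Suc_conv_app_nth)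
  then show ?case using Suc by (auto intro: relpowp_Suc_I)
qed

lemma length_language_in_NP: "length_language A \<in> NP_class A"
proof -
  \<comment> \<open>\<open>[:3, 1:]\<close> takes the value \<open>n + 3\<close> at
    \<open>n\<close>: the guessing steps, then one each to enter the query state, to be answered and
    to accept.\<close>
  have "runs_in_time guess_machine A (poly [:3, 1:])"
    unfolding runs_in_time_def by (auto dest!: guess_machine_run)
  moreover have "accepted_language guess_machine A = length_language A"
  proof (intro set_eqI iffI)
    fix x assume "x \<in> accepted_language guess_machine A"
    then obtain n c where "(step guess_machine A ^^ n) (initial guess_machine x) c" "fst c = 0"
      by (auto simp: accepted_language_def rtranclp_power)
    from guess_machine_run[OF this(1)] this(2) show "x \<in> length_language A"
      by (auto simp: length_language_def split: if_splits)
  next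
    fix x assume "x \<in> length_language A"
    then obtain w where w: "w \<in> A" "length w = length x"
      by (auto simp: length_language_def)
    let ?ts = "[end_tape x, end_tape w]"
    have "(step guess_machine A)\<^sup>*\<^sup>* (initial guess_machine x) (4, ?ts)"
      using guess_machine_guesses[OF w(2) order_refl] w(2)
      by (auto simp: tape_at_length dest: relpowp_imp_rtranclp)
    also have "step guess_machine A (4, ?ts) (1, map2 act [(Blank, Stay), (Blank, Stay)] ?ts)"
      by (rule step.rule) (simp add: guess_machine_def)
    then have "step guess_machine A (4, ?ts) (1, ?ts)" by simp
    also have "step guess_machine A (1, ?ts) (2, ?ts)"
      using step.query[of guess_machine A ?ts] w(1) by simp
    also have "step guess_machine A (2, ?ts) (0, map2 act [(Blank, Stay), (Blank, Stay)] ?ts)"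
      by (rule step.rule) (simp add: guess_machine_def)
    then have "step guess_machine A (2, ?ts) (0, ?ts)" by simp
    finally show "x \<in> accepted_language guess_machine A"
      by (auto simp: accepted_language_def)
  qed
  ultimately show ?thesis
    unfolding NP_class_def using well_formed_guess_machine by blast
qed

lemma poly_less_exponential: "\<exists>N. \<forall>n\<ge>N. poly p n < (2 :: nat) ^ n" for p :: "nat poly"
proof -
  have "(\<lambda>n. real (poly p n) * x ^ n) \<longlonglongrightarrow> 0" if "0 \<le> x" "x < 1" for x :: real
    using that
  proof (induction p arbitrary: x)
    case 0
    then show ?case by simp
  next
    case (pCons a p)
    \<comment> \<open>One factor \<open>?y ^ n\<close> absorbs the additional \<open>n\<close>, the
      other goes to the induction hypothesis, which therefore has to hold for every base.\<close>
    let ?y = "sqrt x"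
    have y: "0 \<le> ?y" "?y < 1" "\<And>n. x ^ n = ?y ^ n * ?y ^ n"
      using pCons.prems by (simp_all flip: power_mult_distrib)
    have "(\<lambda>n. real a * x ^ n + (real n * ?y ^ n) * (real (poly p n) * ?y ^ n)) \<longlonglongrightarrow> real a * 0 + 0 * 0"
      using pCons y by (intro tendsto_intros powser_times_n_limit_0 LIMSEQ_realpow_zero) auto
    then show ?case
      using y(3) by (simp add: algebra_simps)
  qed
  from this[of "1 / 2"] have "eventually (\<lambda>n. real (poly p n) * (1 / 2) ^ n < 1) sequentially"
    by (intro order_tendstoD) auto
  then obtain N where "\<And>n. n \<ge> N \<Longrightarrow> real (poly p n) * (1 / 2) ^ n < 1"
    by (auto simp: eventually_sequentially)
  then have "\<And>n. n \<ge> N \<Longrightarrow> real (poly p n) < real (2 ^ n)"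
    by (simp add: power_divide)
  then show ?thesis unfolding of_nat_less_iff by blast
qed

section \<open>Closedness and empty interior of the sets of solving oracles\<close>

definition solved_by :: "otm \<times> nat poly \<Rightarrow> (nat \<Rightarrow> bool) set" where
  "solved_by = (\<lambda>(M, p). {\<alpha>. runs_in_time M (oracle_of \<alpha>) (poly p) \<and>
     accepted_language M (oracle_of \<alpha>) = length_language (oracle_of \<alpha>)})"

lemma length_language_agree:
  "agree_below n A B \<Longrightarrow> length x < n \<Longrightarrow> x \<in> length_language A \<longleftrightarrow> x \<in> length_language B"
  unfolding length_language_def by (auto simp: agree_below_def)

text \<open>Failure shows in a finite computation: some run exceeds the bound, or some input is
  answered wrongly. A cylinder that fixes all strings short enough to be queried preserves the
  failure.\<close>

lemma closed_solved_by:
  assumes "well_formed M"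
  shows "closed (solved_by (M, p))"
  unfolding closed_def open_iff_cylinder
proof
  fix \<alpha> assume \<alpha>: "\<alpha> \<in> - solved_by (M, p)"
  let ?A = "oracle_of \<alpha>"
  show "\<exists>n. \<forall>\<beta>. agree_below n ?A (oracle_of \<beta>) \<longrightarrow> \<beta> \<in> - solved_by (M, p)"
  proof (cases "runs_in_time M ?A (poly p)")
    case False
    then obtain x n c where "(step M ?A ^^ n) (initial M x) c" "n > poly p (length x)"
      by (auto simp: runs_in_time_def not_le)
    then have "\<beta> \<in> - solved_by (M, p)" if "agree_below n ?A (oracle_of \<beta>)" for \<beta>
    proof -
      have "(step M (oracle_of \<beta>) ^^ n) (initial M x) c"
        using run_agree[OF assms that] \<open>(step M ?A ^^ n) (initial M x) c\<close> .
      then have "\<not> runs_in_time M (oracle_of \<beta>) (poly p)"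
        using \<open>n > poly p (length x)\<close> unfolding runs_in_time_def by (meson not_le)
      then show ?thesis by (simp add: solved_by_def)
    qed
    then show ?thesis by blast
  next
    case True
    then obtain x where x: "\<not> (x \<in> accepted_language M ?A \<longleftrightarrow> x \<in> length_language ?A)"
      using \<alpha> by (auto simp: solved_by_def)
    let ?t = "poly p (length x)"
    \<comment> \<open>\<open>?t\<close> preserves the clocked computation on \<open>x\<close>, and
      \<open>Suc (length x)\<close> the presence of strings as long as \<open>x\<close>.\<close>
    have "\<beta> \<in> - solved_by (M, p)" if *: "agree_below (?t + Suc (length x)) ?A (oracle_of \<beta>)" for \<beta>
    proof
      assume "\<beta> \<in> solved_by (M, p)"
      then have \<beta>: "runs_in_time M (oracle_of \<beta>) (poly p)"
        "x \<in> accepted_language M (oracle_of \<beta>) \<longleftrightarrow> x \<in> length_language (oracle_of \<beta>)"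
        by (auto simp: solved_by_def)
      have "accepts_within M ?A ?t x \<longleftrightarrow> accepts_within M (oracle_of \<beta>) ?t x"
        using accepts_within_agree[OF assms] agree_below_mono[OF *] by simp
      moreover have "x \<in> length_language ?A \<longleftrightarrow> x \<in> length_language (oracle_of \<beta>)"
        using length_language_agree[OF *] by simp
      ultimately show False
        using x \<beta>(2) accepts_within_iff[OF \<beta>(1)] accepts_within_iff[OF True] by simp
    qed
    then show ?thesis by blast
  qed
qed

lemma obtain_oracle_of: obtains \<alpha> where "oracle_of \<alpha> = A"
  using bij_oracle_of by (metis bij_pointE)

text \<open>Below the time bound only \<open>p n\<close> of the \<open>2 ^ n\<close> strings of length \<open>n\<close> are queried, so some string
  of this length can be added to the oracle without changing the computation.\<close>

lemma no_cylinder_in_solved_by: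
  assumes "well_formed M" "deterministic M"
  shows "\<exists>\<beta>. agree_below k A (oracle_of \<beta>) \<and> \<beta> \<notin> solved_by (M, p)"
proof (rule ccontr)
  assume no: "\<not> ?thesis"
  have solved: "runs_in_time M B (poly p) \<and> accepted_language M B = length_language B"
    if "agree_below k A B" for B
  proof -
    obtain \<beta> where \<beta>: "oracle_of \<beta> = B" by (rule obtain_oracle_of)
    then have "\<beta> \<in> solved_by (M, p)" using that no by blast
    then show ?thesis using \<beta> by (simp add: solved_by_def)
  qed
  obtain N where N: "\<And>n. n \<ge> N \<Longrightarrow> poly p n < (2 :: nat) ^ n"
    using poly_less_exponential by blast
  \<comment> \<open>\<open>N\<close> leaves an unqueried string of length \<open>n\<close>;
    \<open>k\<close> keeps its addition compatible with the condition and ensures that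
    \<open>A\<^sub>0\<close> has no string of this length.\<close>
  define n where "n = max k N"
  define x where "x = replicate n False"
  define A\<^sub>0 where "A\<^sub>0 = {w \<in> A. length w < k}"
  have A\<^sub>0: "agree_below k A A\<^sub>0" by (auto simp: agree_below_def A\<^sub>0_def)
  note runs = conjunct1[OF solved[OF A\<^sub>0]] and acc = conjunct2[OF solved[OF A\<^sub>0]]
  \<comment> \<open>The unique run as a total function; its values are arbitrary once the run has
    halted.\<close>
  define conf where "conf i = (THE c. (step M A\<^sub>0 ^^ i) (initial M x) c)" for i
  have conf: "conf i = c" if "(step M A\<^sub>0 ^^ i) (initial M x) c" for i c
    unfolding conf_def
  proof (rule the_equality)
    show "(step M A\<^sub>0 ^^ i) (initial M x) c" by (rule that)
    fix d assume d: "(step M A\<^sub>0 ^^ i) (initial M x) d"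
    have "right_unique (step M A\<^sub>0 ^^ i)"
    proof (induction i)
      case (Suc i)
      then show ?case by (simp add: right_unique_OO right_unique_step[OF assms])
    qed (simp add: right_unique_eq)
    then show "d = c" using that d by (auto dest: right_uniqueD)
  qed
  have "card ((\<lambda>i. tape_word (snd (conf i) ! 1)) ` {..<poly p n}) \<le> poly p n"
    using card_image_le[of "{..<poly p n}"] by simp
  also have "\<dots> < card {w :: bool list. length w = n}"
    using N[of n] card_lists_length_eq[of "UNIV :: bool set" n] by (simp add: n_def)
  finally obtain w where w: "length w = n" "w \<notin> (\<lambda>i. tape_word (snd (conf i) ! 1)) ` {..<poly p n}"
    by (metis (mono_tags, lifting) card_mono finite_imageI finite_lessThan leD mem_Collect_eq subsetI)
  define A\<^sub>1 where "A\<^sub>1 = insert w A\<^sub>0"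
  have A\<^sub>1: "agree_below k A A\<^sub>1" using A\<^sub>0 w(1) by (auto simp: agree_below_def A\<^sub>1_def n_def)
  have run: "(step M A\<^sub>0 ^^ i) (initial M x) c" if "(step M A\<^sub>1 ^^ i) (initial M x) c" for i c
    using that
  proof (induction i arbitrary: c)
    case 0
    then show ?case by simp
  next
    case (Suc i)
    then obtain b where b: "(step M A\<^sub>1 ^^ i) (initial M x) b" "step M A\<^sub>1 b c"
      by (auto elim: relpowp_Suc_E)
    note b0 = Suc.IH[OF b(1)]
    from b(2) have "step M A\<^sub>0 b c"
    proof cases
      case (rule q ts q' as)
      then show ?thesis using step.rule by blast
    next
      case (query ts)
      \<comment> \<open>The query step exists relative to \<open>A\<^sub>0\<close> whatever the
        answer, so the time bound gives \<open>i < poly p n\<close>. Hence this query is among those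
        that \<open>w\<close> avoids, and both oracles answer alike.\<close>
      have "step M A\<^sub>0 b (if tape_word (ts ! 1) \<in> A\<^sub>0 then yes_state M else no_state M, ts)"
        unfolding query by (rule step.query)
      then have "(step M A\<^sub>0 ^^ Suc i) (initial M x)
          (if tape_word (ts ! 1) \<in> A\<^sub>0 then yes_state M else no_state M, ts)"
        using b0 by (rule relpowp_Suc_I[rotated])
      then have "Suc i \<le> poly p (length x)"
        using runs unfolding runs_in_time_def by blast
      then have "tape_word (snd (conf i) ! 1) \<noteq> w"
        using w(2) by (auto simp: x_def)
      then have "tape_word (ts ! 1) \<noteq> w"
        using conf[OF b0] query(1) by simp
      then show ?thesis using query step.query[of M A\<^sub>0 ts] by (simp add: A\<^sub>1_def)
    qed
    with b0 show ?case by (rule relpowp_Suc_I)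
  qed
  have "x \<in> length_language A\<^sub>1"
    using w(1) by (auto simp: length_language_def A\<^sub>1_def x_def)
  then have "x \<in> accepted_language M A\<^sub>1" using solved[OF A\<^sub>1] by simp
  then have "x \<in> accepted_language M A\<^sub>0"
    using run unfolding accepted_language_def rtranclp_power by blast
  then have "x \<in> length_language A\<^sub>0" using acc by simp
  then show False by (auto simp: length_language_def A\<^sub>0_def x_def n_def)
qed

section \<open>A dense set of oracles collapsing \<open>NP\<close> to \<open>P\<close>\<close>

lemma P_class_subset_NP_class: "P_class A \<subseteq> NP_class A"
  by (auto simp: P_class_def NP_class_def)

text \<open>Leading ones give a machine index in unary, trailing ones are padding. The two zeros let
  \<open>x\<close> be any string: parsing from the left and, after reversal, from the right recovers
  all three parts.\<close>

definition codeword :: "nat \<Rightarrow> bool list \<Rightarrow> nat \<Rightarrow> bool list" where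
  "codeword m x j = replicate m True @ False # x @ False # replicate j True"

lemma replicate_True_cancel:
  "replicate m True @ False # x = replicate n True @ False # y \<longleftrightarrow> m = n \<and> x = y"
proof (induction m arbitrary: n)
  case 0
  then show ?case by (cases n) auto
next
  case (Suc m)
  then show ?case by (cases n) auto
qed

lemma codeword_inject: "codeword m x i = codeword n y j \<longleftrightarrow> m = n \<and> x = y \<and> i = j"
proof -
  have "x @ False # replicate i True = y @ False # replicate j True \<longleftrightarrow> x = y \<and> i = j"
    using replicate_True_cancel[of i "rev x" j "rev y"]
      rev_is_rev_conv[of "x @ False # replicate i True" "y @ False # replicate j True"]
    by auto
  then show ?thesis
    by (simp add: codeword_def replicate_True_cancel)
qed

lemma length_codeword: "length (codeword m x j) = m + length x + j + 2"
  by (simp add: codeword_def)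

text \<open>Well-founded recursion on length: the truncation to shorter strings makes
  \<open>F\<close> admissible for any \<open>G\<close>, so an oracle may refer to itself.\<close>

lemma self_referential_oracle:
  "\<exists>A. \<forall>w. w \<in> A \<longleftrightarrow> G {v \<in> A. length v < length w} w"
proof -
  define F where "F f w = G {v. f v \<and> length v < length w} w" for f w
  define f where "f = wfrec (Wellfounded.measure length) F"
  have "adm_wf (Wellfounded.measure length) F"
    by (auto simp: adm_wf_def F_def intro!: arg_cong[where f = "\<lambda>B. G B _"])
  then have "f = F f"
    unfolding f_def by (intro wfrec_fixpoint) auto
  then have f: "f w = G {v. f v \<and> length v < length w} w" for w
    unfolding F_def by (rule fun_cong)
  show ?thesis
  proof (intro exI allI)
    fix w show "w \<in> {v. f v} \<longleftrightarrow> G {v \<in> {v. f v}. length v < length w} w"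
      unfolding mem_Collect_eq by (rule f)
  qed
qed

text \<open>Codewords of length below \<open>k\<close> do not occur since the number \<open>k + m\<close> of leading ones is
  at least \<open>k\<close>, and the queries made within the time bound are shorter than the codeword,
  so that the recursion is well founded.\<close>

lemma obtain_collapsing_oracle:
  fixes e :: "nat \<Rightarrow> otm \<times> nat poly"
  assumes "\<And>m. well_formed (fst (e m))"
  defines "t \<equiv> \<lambda>m x. poly (snd (e m)) (length x)"
  obtains A where "agree_below k S A"
    "\<And>m x j. codeword (k + m) x j \<in> A \<longleftrightarrow>
       j = t m x \<or> j = Suc (t m x) \<and> accepts_within (fst (e m)) A (t m x) x"
proof -
  \<comment> \<open>Padding of length \<open>t m x\<close> signals that the clock has been reached,
    and the next length carries the answer; no other codeword with this index and input is put into
    the oracle.\<close>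
  define G where "G B w \<longleftrightarrow> (if length w < k then w \<in> S else
      \<exists>m x j. w = codeword (k + m) x j \<and>
        (j = t m x \<or> j = Suc (t m x) \<and> accepts_within (fst (e m)) B (t m x) x))" for B w
  obtain A where A: "\<And>w. w \<in> A \<longleftrightarrow> G {v \<in> A. length v < length w} w"
    using self_referential_oracle[of G] by blast
  show thesis
  proof
    show "agree_below k S A"
      unfolding agree_below_def using A by (metis G_def)
    fix m x j
    let ?B = "{v \<in> A. length v < length (codeword (k + m) x j)}"
    have "codeword (k + m) x j \<in> A \<longleftrightarrow> G ?B (codeword (k + m) x j)" by (rule A)
    also have "\<dots> \<longleftrightarrow> j = t m x \<or> j = Suc (t m x) \<and> accepts_within (fst (e m)) ?B (t m x) x"
      by (simp add: G_def codeword_inject length_codeword)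
    finally have *: "codeword (k + m) x j \<in> A \<longleftrightarrow>
       j = t m x \<or> j = Suc (t m x) \<and> accepts_within (fst (e m)) ?B (t m x) x" .
    have "accepts_within (fst (e m)) ?B (t m x) x \<longleftrightarrow> accepts_within (fst (e m)) A (t m x) x"
      if "j = Suc (t m x)"
      using that by (intro accepts_within_agree assms(1)) (simp add: agree_below_def length_codeword)
    with * show "codeword (k + m) x j \<in> A \<longleftrightarrow>
       j = t m x \<or> j = Suc (t m x) \<and> accepts_within (fst (e m)) A (t m x) x"
      by blast
  qed
qed

text \<open>The machine asks the oracle about \<open>codeword K x j\<close> for \<open>j = 0, 1, \<dots>\<close> until the answer is yes.
  It then marks the input tape, asks about the next codeword, and accepts if the answer is again
  yes.  States are numbered as for \<^const>\<open>guess_machine\<close>.\<close>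

definition search_machine :: "nat \<Rightarrow> otm" where
  "search_machine K = OTM 2
     ((\<lambda>(i, a). (4 + i, [a, Blank], 5 + i, [(a, Stay), (Bit (i < K), Go_right)])) `
        ({..K} \<times> {Bit False, Bit True, Blank}) \<union>
      (\<lambda>b. (5 + K, [Bit b, Blank], 5 + K, [(Bit b, Go_right), (Bit b, Go_right)])) ` UNIV \<union>
      {(5 + K, [Blank, Blank], 1, [(Blank, Stay), (Bit False, Go_right)]),
       (3, [Blank, Blank], 1, [(Blank, Stay), (Bit True, Go_right)]),
       (2, [Blank, Blank], 1, [(Bit True, Stay), (Bit True, Go_right)]),
       (2, [Bit True, Blank], 0, [(Bit True, Stay), (Blank, Stay)])})
     4 0 1 2 3"

lemma search_machine_sel [simp]:
  "num_tapes (search_machine K) = 2" "start_state (search_machine K) = 4"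
  "accept_state (search_machine K) = 0" "query_state (search_machine K) = 1"
  "yes_state (search_machine K) = 2" "no_state (search_machine K) = 3"
  by (simp_all add: search_machine_def)

lemma well_formed_search_machine: "well_formed (search_machine K)"
  by (auto simp: well_formed_def search_machine_def)

lemma deterministic_search_machine: "deterministic (search_machine K)"
  unfolding deterministic_def search_machine_def by auto

section \<open>Runs of the search machine\<close>

context
  fixes K :: nat and A :: "bool list set" and x :: "bool list"
begin

abbreviation (input) "R \<equiv> step (search_machine K) A"
abbreviation (input) "marked \<equiv> (int (length x), (cells x)(int (length x) := Bit True))"

lemma search_machine_rule:
  "(q, map scanned ts, q', as) \<in> rules (search_machine K) \<Longrightarrow> ts' = map2 act as ts \<Longrightarrow> R (q, ts) (q', ts')"
  by (simp add: step.rule)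

lemma search_machine_query:
  "R (1, [s, end_tape w]) (if w \<in> A then 2 else 3, [s, end_tape w])"
  using step.query[of "search_machine K" A "[s, end_tape w]"] by (cases "w \<in> A") simp_all

lemma search_machine_prefix:
  "i \<le> K \<Longrightarrow> (R ^^ i) (initial (search_machine K) x) (4 + i, [tape_at x 0, end_tape (replicate i True)])"
proof (induction i)
  case 0
  then show ?case by (simp add: initial_two_tapes)
next
  case (Suc i)
  have "scanned (tape_at x 0) \<in> {Bit False, Bit True, Blank}"
    by (auto simp: tape_at_def cells_def)
  then have "R (4 + i, [tape_at x 0, end_tape (replicate i True)])
      (4 + Suc i, [tape_at x 0, end_tape (replicate (Suc i) True)])"
    using Suc.prems
    by (intro search_machine_rule[where as = "[(scanned (tape_at x 0), Stay), (Bit True, Go_right)]"])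
      (auto simp: search_machine_def image_iff replicate_append_same)
  then show ?case using Suc by (auto intro: relpowp_Suc_I)
qed

lemma search_machine_separator:
  "R (4 + K, [tape_at x 0, end_tape w]) (5 + K, [tape_at x 0, end_tape (w @ [False])])"
proof -
  have "scanned (tape_at x 0) \<in> {Bit False, Bit True, Blank}"
    by (auto simp: tape_at_def cells_def)
  then show ?thesis
    by (intro search_machine_rule[where as = "[(scanned (tape_at x 0), Stay), (Bit False, Go_right)]"])
      (auto simp: search_machine_def image_iff)
qed

lemma search_machine_copy:
  "i \<le> length x \<Longrightarrow>
     (R ^^ i) (5 + K, [tape_at x 0, end_tape w]) (5 + K, [tape_at x i, end_tape (w @ take i x)])"
proof (induction i)
  case 0
  then show ?case by simp
next
  case (Suc i)
  then have "R (5 + K, [tape_at x i, end_tape (w @ take i x)])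
      (5 + K, [tape_at x (Suc i), end_tape (w @ take (Suc i) x)])"
    by (intro search_machine_rule[where as = "[(Bit (x ! i), Go_right), (Bit (x ! i), Go_right)]"])
      (auto simp: search_machine_def take_Suc_conv_app_nth)
  then show ?case using Suc by (auto intro: relpowp_Suc_I)
qed

text \<open>Each codeword answered no costs two steps, the query and the appending of a one.\<close>

lemma search_machine_search:
  assumes "\<And>i. i < j \<Longrightarrow> w @ replicate i True \<notin> A"
  shows "(R ^^ (2 * j)) (1, [end_tape x, end_tape w]) (1, [end_tape x, end_tape (w @ replicate j True)])"
  using assms
proof (induction j)
  case 0
  then show ?case by simp
next
  case (Suc j)
  have "R (1, [end_tape x, end_tape (w @ replicate j True)])
      (3, [end_tape x, end_tape (w @ replicate j True)])"
    using search_machine_query[of "end_tape x" "w @ replicate j True"] Suc.prems by simp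
  moreover have "R (3, [end_tape x, end_tape (w @ replicate j True)])
      (1, [end_tape x, end_tape (w @ replicate (Suc j) True)])"
    by (rule search_machine_rule[where as = "[(Blank, Stay), (Bit True, Go_right)]"])
      (auto simp: search_machine_def replicate_append_same)
  ultimately show ?case
    using Suc by (auto intro!: relpowp_Suc_I)
qed

lemma search_machine_initial_query:
  "(R ^^ (K + length x + 2)) (initial (search_machine K) x) (1, [end_tape x, end_tape (codeword K x 0)])"
proof -
  let ?w = "replicate K True @ [False]"
  have "(R ^^ Suc K) (initial (search_machine K) x) (5 + K, [tape_at x 0, end_tape ?w])"
    using relpowp_Suc_I[OF search_machine_prefix search_machine_separator] by simp
  then have "(R ^^ (Suc K + length x)) (initial (search_machine K) x) (5 + K, [end_tape x, end_tape (?w @ x)])"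
    using relpowp_trans[OF _ search_machine_copy[of "length x"]]
    by (simp add: tape_at_length del: relpowp.simps append_assoc add_Suc)
  moreover have "R (5 + K, [end_tape x, end_tape (?w @ x)]) (1, [end_tape x, end_tape (codeword K x 0)])"
    by (rule search_machine_rule[where as = "[(Blank, Stay), (Bit False, Go_right)]"])
      (auto simp: search_machine_def codeword_def)
  ultimately have "(R ^^ Suc (Suc K + length x)) (initial (search_machine K) x)
      (1, [end_tape x, end_tape (codeword K x 0)])"
    by (rule relpowp_Suc_I)
  then show ?thesis by simp
qed

lemma codeword_add: "codeword K x 0 @ replicate j True = codeword K x j"
  by (simp add: codeword_def)

text \<open>The four steps are the first yes, marking and lengthening the query, the second answer,
  and acceptance; a second answer no halts after three.\<close>

lemma search_machine_final:
  assumes "w \<in> A"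
  shows "\<exists>n\<le>4. \<exists>c. (R ^^ n) (1, [end_tape x, end_tape w]) c \<and> (\<forall>c'. \<not> R c c') \<and>
    (fst c = 0 \<longleftrightarrow> w @ [True] \<in> A)"
proof -
  have "R (1, [end_tape x, end_tape w]) (2, [end_tape x, end_tape w])"
    using search_machine_query[of "end_tape x" w] assms by simp
  \<comment> \<open>The mark is a bit in the blank cell after the input. It tells the two answers
    apart: a second yes accepts and a second no finds no rule.\<close>
  moreover have "R (2, [end_tape x, end_tape w]) (1, [marked, end_tape (w @ [True])])"
    by (rule search_machine_rule[where as = "[(Bit True, Stay), (Bit True, Go_right)]"])
      (auto simp: search_machine_def, simp add: end_tape_def)
  ultimately have 2: "(R ^^ 2) (1, [end_tape x, end_tape w]) (1, [marked, end_tape (w @ [True])])"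
    by (auto simp: numeral_2_eq_2)
  have 3: "(R ^^ 3) (1, [end_tape x, end_tape w])
      (if w @ [True] \<in> A then 2 else 3, [marked, end_tape (w @ [True])])"
    using relpowp_Suc_I[OF 2 search_machine_query] by (simp add: eval_nat_numeral)
  show ?thesis
  proof (cases "w @ [True] \<in> A")
    case True
    have "R (2, [marked, end_tape (w @ [True])]) (0, [marked, end_tape (w @ [True])])"
      by (rule search_machine_rule[where as = "[(Bit True, Stay), (Blank, Stay)]"])
        (auto simp: search_machine_def)
    then have "(R ^^ 4) (1, [end_tape x, end_tape w]) (0, [marked, end_tape (w @ [True])])"
      using relpowp_Suc_I[OF 3] True by (simp add: eval_nat_numeral)
    then show ?thesis
      using True accept_halts[OF well_formed_search_machine] by fastforce
  next
    case False
    have "\<not> R (3, [marked, end_tape (w @ [True])]) c'" for c'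
      by (auto simp: search_machine_def elim!: step.cases)
    then show ?thesis
      using 3 False
      by (intro exI[of _ 3] conjI exI[of _ "(3, [marked, end_tape (w @ [True])])"]) auto
  qed
qed

end

text \<open>The bound adds \<open>K + length x + 2\<close> steps for reaching the first query,
  \<open>2 * t\<close> for the search and at most \<open>4\<close> for the end.\<close>

lemma search_machine_run:
  assumes "\<And>i. i \<le> t \<Longrightarrow> codeword K x i \<in> A \<longleftrightarrow> i = t"
  obtains N d where "N \<le> K + length x + 2 * t + 6"
    "(step (search_machine K) A ^^ N) (initial (search_machine K) x) d"
    "\<And>e. \<not> step (search_machine K) A d e" "fst d = 0 \<longleftrightarrow> codeword K x (Suc t) \<in> A"
proof -
  let ?R = "step (search_machine K) A"
  have start: "(?R ^^ (K + length x + 2 + 2 * t)) (initial (search_machine K) x)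
      (1, [end_tape x, end_tape (codeword K x t)])"
    using relpowp_trans[OF search_machine_initial_query search_machine_search[of t "codeword K x 0"]]
      assms by (simp add: codeword_add)
  obtain n d where "n \<le> 4" and final: "(?R ^^ n) (1, [end_tape x, end_tape (codeword K x t)]) d"
    and "\<And>e. \<not> ?R d e" "fst d = 0 \<longleftrightarrow> codeword K x (Suc t) \<in> A"
    using search_machine_final[where w = "codeword K x t" and A = A and x = x and K = K] assms[of t]
    by (auto simp: codeword_def replicate_append_same)
  then show thesis
    using that[OF _ relpowp_trans[OF start final]] by simp
qed

text \<open>The oracle reveals the value of \<open>p\<close>, so \<open>p\<close> enters the time
  bound \<open>?q\<close> but not the machine. By determinism the halting run from
  \<open>search_machine_run\<close> bounds all runs and decides acceptance.\<close>

lemma search_machine_in_P: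
  fixes p :: "nat poly"
  assumes "\<And>x i. i \<le> poly p (length x) \<Longrightarrow> codeword K x i \<in> A \<longleftrightarrow> i = poly p (length x)"
  shows "{x. codeword K x (Suc (poly p (length x))) \<in> A} \<in> P_class A"
proof -
  let ?M = "search_machine K"
  let ?R = "step ?M A"
  let ?q = "[:K + 6, 1:] + smult 2 p"
  note ru = right_unique_step[OF well_formed_search_machine deterministic_search_machine, of K A]
  have "runs_in_time ?M A (poly ?q)"
    unfolding runs_in_time_def
  proof (intro allI impI)
    fix x n c assume c: "(?R ^^ n) (initial ?M x) c"
    obtain N d where "N \<le> K + length x + 2 * poly p (length x) + 6" "(?R ^^ N) (initial ?M x) d"
      "\<And>e. \<not> ?R d e"
      by (rule search_machine_run[where x = x, OF assms]) (assumption, rule that)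
    with right_unique_run[OF ru _ _ c] show "n \<le> poly ?q (length x)" by fastforce
  qed
  moreover have "x \<in> accepted_language ?M A \<longleftrightarrow> codeword K x (Suc (poly p (length x))) \<in> A" for x
  proof -
    obtain N d where d: "(?R ^^ N) (initial ?M x) d" "\<And>e. \<not> ?R d e"
      "fst d = 0 \<longleftrightarrow> codeword K x (Suc (poly p (length x))) \<in> A"
      by (rule search_machine_run[where x = x, OF assms]) (assumption, rule that)
    have "c = d" if c: "(?R ^^ n) (initial ?M x) c" "fst c = 0" for n c
    proof -
      \<comment> \<open>An accepting configuration has no successor, so the rest of the run to
        \<open>d\<close> is empty.\<close>
      obtain m where "(?R ^^ m) c d" using right_unique_run[OF ru d(1,2) c(1)] by blast
      then show ?thesis
        using accept_halts[OF well_formed_search_machine, of c K A] c(2)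
        by (cases m) (auto simp del: relpowp.simps(2) dest: relpowp_Suc_D2)
    qed
    then have "(\<exists>n c. (?R ^^ n) (initial ?M x) c \<and> fst c = 0) \<longleftrightarrow> fst d = 0"
      using d(1) by metis
    then show ?thesis
      unfolding d(3)[symmetric] by (auto simp: accepted_language_def rtranclp_power)
  qed
  ultimately show ?thesis
    unfolding P_class_def
    using well_formed_search_machine deterministic_search_machine by blast
qed

section \<open>Enumeration of the clocked machines, and density\<close>

instance tape_symbol :: countable by countable_datatype
instance head_move :: countable by countable_datatype

text \<open>Well-formed machines are finite data over countable types, their rule sets being finite;
  a polynomial is given by its list of coefficients.\<close>

lemma countable_machines: "countable {(M, p :: nat poly). well_formed M}"
proof -
  let ?S = "(UNIV :: nat set) \<times> {r :: rule set. finite r} \<times> (UNIV :: (nat \<times> nat \<times> nat \<times> nat \<times> nat) set)"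
  have "{M. well_formed M} \<subseteq> (\<lambda>(k, r, s, a, q, y, n). OTM k r s a q y n) ` ?S"
  proof
    fix M assume "M \<in> {M. well_formed M}"
    then show "M \<in> (\<lambda>(k, r, s, a, q, y, n). OTM k r s a q y n) ` ?S"
      by (cases M) (auto simp: well_formed_def image_iff)
  qed
  moreover have "countable ?S"
    by (intro countable_SIGMA countable_Collect_finite countableI_type)
  ultimately have 1: "countable {M. well_formed M}"
    by (meson countable_image countable_subset)
  have "(UNIV :: nat poly set) = range Poly"
    by (metis Poly_coeffs surjI)
  then have "countable (UNIV :: nat poly set)"
    by (metis countableI_type countable_image)
  with 1 have "countable ({M. well_formed M} \<times> (UNIV :: nat poly set))" by simp
  then show ?thesis by (rule countable_subset[rotated]) auto
qed

text \<open>All pairs of a well-formed machine and a clock are enumerated, also those where the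
  clock is overrun. A language in \<open>NP_class A\<close> comes from a pair that obeys its clock,
  and membership is then read off the codewords with padding
  \<open>Suc (poly p (length x))\<close>.\<close>

lemma dense_P_eq_NP: "\<exists>A. agree_below k S A \<and> P_class A = NP_class A"
proof -
  let ?V = "{(M, p :: nat poly). well_formed M}"
  define e where "e = from_nat_into ?V"
  have "?V \<noteq> {}" using well_formed_guess_machine by auto
  then have range: "range e = ?V"
    using countable_machines by (simp add: e_def range_from_nat_into)
  then have wf: "well_formed (fst (e m))" for m
    using rangeI[of e m] by auto
  obtain A where A: "agree_below k S A" "\<And>m x j. codeword (k + m) x j \<in> A \<longleftrightarrow>
      j = poly (snd (e m)) (length x) \<or> j = Suc (poly (snd (e m)) (length x)) \<and>
      accepts_within (fst (e m)) A (poly (snd (e m)) (length x)) x"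
    using obtain_collapsing_oracle[of e k S] wf by blast
  have "L \<in> P_class A" if "L \<in> NP_class A" for L
  proof -
    obtain M p where M: "well_formed M" "runs_in_time M A (poly p)" "L = accepted_language M A"
      using \<open>L \<in> NP_class A\<close> unfolding NP_class_def by blast
    then obtain m where m: "e m = (M, p)" using range by (metis (no_types, lifting) case_prodI imageE mem_Collect_eq)
    have "L = {x. codeword (k + m) x (Suc (poly p (length x))) \<in> A}"
      using accepts_within_iff[OF M(2)] A(2)[of m] m M(3) by auto
    also have "\<dots> \<in> P_class A"
      using A(2)[of m] m by (intro search_machine_in_P) auto
    finally show ?thesis .
  qed
  then show ?thesis using A(1) P_class_subset_NP_class by blast
qed

section \<open>The Baire category argument\<close>

theorem theorem2p4:
  shows "Pi02_hard P_neq_NP_oracles"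
proof -
  have False if fs: "fsigma P_neq_NP_oracles"
  proof -
    from fs obtain F :: "nat \<Rightarrow> (nat \<Rightarrow> bool) set"
      where F: "\<And>i. closed (F i)" "P_neq_NP_oracles = \<Union>(range F)"
      unfolding fsigma.simps by blast
    define V where "V = {(M, p :: nat poly). well_formed M \<and> deterministic M}"
    have "countable V"
      using countable_machines by (rule countable_subset[rotated]) (auto simp: V_def)
    then have "countable (range F \<union> solved_by ` V)" by simp
    moreover have "closed T" if "T \<in> range F \<union> solved_by ` V" for T
      using that F(1) closed_solved_by by (auto simp: V_def)
    moreover have "\<Union>(range F \<union> solved_by ` V) = UNIV"
    proof -
      have "\<alpha> \<in> \<Union>(solved_by ` V)" if "\<alpha> \<notin> P_neq_NP_oracles" for \<alpha>
      proof -
        have "length_language (oracle_of \<alpha>) \<in> P_class (oracle_of \<alpha>)"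
          using that length_language_in_NP by (simp add: P_neq_NP_oracles_def)
        then show ?thesis by (auto simp: P_class_def V_def solved_by_def)
      qed
      then have "P_neq_NP_oracles \<union> \<Union>(solved_by ` V) = UNIV" by blast
      then show ?thesis by (simp only: F(2) Union_Un_distrib)
    qed
    ultimately obtain T A n where T: "T \<in> range F \<union> solved_by ` V"
      and cyl: "\<And>\<beta>. agree_below n A (oracle_of \<beta>) \<Longrightarrow> \<beta> \<in> T"
      by (rule Baire_Cantor_space) (assumption, rule that)
    from T consider i where "T = F i" | M p where "(M, p) \<in> V" "T = solved_by (M, p)" by auto
    then show False
    proof cases
      case 1
      obtain B where B: "agree_below n A B" "P_class B = NP_class B"
        using dense_P_eq_NP by blast
      obtain \<beta> where \<beta>: "oracle_of \<beta> = B" by (rule obtain_oracle_of)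
      with B cyl 1 F(2) have "\<beta> \<in> P_neq_NP_oracles" by blast
      with B(2) \<beta> show False by (simp add: P_neq_NP_oracles_def)
    next
      case 2
      then show False
        using no_cylinder_in_solved_by[of M n A p] cyl by (auto simp: V_def)
    qed
  qed
  then show ?thesis by (auto simp: Pi02_hard_def Sigma02_def)
qed

end
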